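(* Let $V$ be a finite set, let $W_1,\ldots,W_m\subseteq V$ be given subsets, and suppose that to each subset $U\subseteq V$ a nonnegative weight $\alpha_U\in[0,\infty)$ is assigned. Let $$\beta=\min_{1\le i\le m;\ W\subseteq W_i}\frac{\sum_{U\subseteq V;\ U\cap W\ne\emptyset}\alpha_U}{|W|}.$$ Then for any independent random variables $Z_1,\ldots,Z_m$ and any random variables $X_v$, $v\in V$, each taking finitely many values and such that each $X_v$ is a measurable function of those $Z_i$ for which $v\in W_i$, the following inequality holds: $$\sum_{U\subseteq V}\alpha_U H(X_U)\ \ge\ \beta\sum_{v\in V}H(X_v).$$ Moreover, the inequality is sharp: $\beta$ is the largest coefficient for which it holds for all random variables $Z_1,\ldots,Z_m$ and $X_v$, $v\in V$, as described.
   Context: For $U\subseteq V$, $X_U=(X_v)_{v\in U}$ and $H(X_U)$ is the joint Shannon entropy, i.e. the entropy $\sum_j -p_j\log p_j$ of the joint distribution of $(X_v)_{v\in U}$. The minimum is over all pairs $(i,W)$ with $W$ a nonempty subset of $W_i$; at least one $W_i$ is nonempty so that such pairs exist. *)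

theory Defs
  imports "HOL-Probability.Probability"
begin

definition H :: "'a measure \<Rightarrow> real \<Rightarrow> ('a \<Rightarrow> 'x) \<Rightarrow> real" where
  "H M b X = prob_space.entropy M b (count_space (X ` space M)) X"

text \<open>The library entropy is a negated Kullback-Leibler divergence from the counting
  measure; on finitely valued random variables this is the usual Shannon sum.\<close>

lemma H_eq_sum:
  assumes "information_space M b" and X: "simple_function M X"
  shows "H M b X = (\<Sum>x\<in>X ` space M.
    - measure M (X -` {x} \<inter> space M) * log b (measure M (X -` {x} \<inter> space M)))"
proof -
  interpret information_space M b by fact
  have "simple_distributed M X (\<lambda>x. measure M (X -` {x} \<inter> space M))"
    by (rule simple_distributedI[OF X]) (simp_all add: measure_nonneg)
  from entropy_simple_distributed[OF this] show ?thesis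
    by (simp add: H_def sum_negf)
qed

definition joint :: "('v \<Rightarrow> 'a \<Rightarrow> 'x) \<Rightarrow> 'v set \<Rightarrow> 'a \<Rightarrow> 'v \<Rightarrow> 'x" where
  "joint X U = (\<lambda>\<omega>. \<lambda>v\<in>U. X v \<omega>)"

definition beta :: "'v set \<Rightarrow> nat \<Rightarrow> (nat \<Rightarrow> 'v set) \<Rightarrow> ('v set \<Rightarrow> real) \<Rightarrow> real" where
  "beta V m W \<alpha> =
    Min {(\<Sum>U\<in>{U. U \<subseteq> V \<and> U \<inter> S \<noteq> {}}. \<alpha> U) / real (card S) | i S.
           i \<in> {1..m} \<and> S \<subseteq> W i \<and> S \<noteq> {}}"

text \<open>The \<open>Z i\<close> are independent, with values in arbitrary measurable spaces \<open>N i\<close>, while the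
  \<open>X v\<close> take finitely many values. If \<open>v\<close> lies in no \<open>W i\<close>, then \<open>X v\<close> is a function of the
  empty tuple, i.e. constant.\<close>

definition admissible ::
  "'v set \<Rightarrow> nat \<Rightarrow> (nat \<Rightarrow> 'v set) \<Rightarrow> 'a measure \<Rightarrow> (nat \<Rightarrow> 'z measure) \<Rightarrow>
     (nat \<Rightarrow> 'a \<Rightarrow> 'z) \<Rightarrow> ('v \<Rightarrow> 'a \<Rightarrow> 'x) \<Rightarrow> bool" where
  "admissible V m W M N Z X \<longleftrightarrow>
     prob_space M \<and>
     prob_space.indep_vars M N Z {1..m} \<and>
     (\<forall>v\<in>V. simple_function M (X v) \<and>
        (\<exists>f \<in> (\<Pi>\<^sub>M i\<in>{i\<in>{1..m}. v \<in> W i}. N i) \<rightarrow>\<^sub>M count_space UNIV.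
           \<forall>\<omega>\<in>space M. X v \<omega> = f (\<lambda>i\<in>{i\<in>{1..m}. v \<in> W i}. Z i \<omega>)))"

text \<open>Validity of the inequality with coefficient \<open>c\<close> for all random variables as described.
  The first argument only fixes the types of the sample space, of the values of the \<open>Z i\<close>
  and of the values of the \<open>X v\<close>, as types cannot be quantified inside a formula.\<close>

definition valid_coefficient ::
  "('a \<times> 'z \<times> 'x) itself \<Rightarrow> real \<Rightarrow> 'v set \<Rightarrow> nat \<Rightarrow> (nat \<Rightarrow> 'v set) \<Rightarrow>
     ('v set \<Rightarrow> real) \<Rightarrow> real \<Rightarrow> bool" where
  "valid_coefficient _ b V m W \<alpha> c \<longleftrightarrow>
     (\<forall>(M :: 'a measure) (N :: nat \<Rightarrow> 'z measure) Z (X :: 'v \<Rightarrow> 'a \<Rightarrow> 'x).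
        admissible V m W M N Z X \<longrightarrow>
        (\<Sum>U\<in>Pow V. \<alpha> U * H M b (joint X U)) \<ge> c * (\<Sum>v\<in>V. H M b (X v)))"

end

theory Submission
  imports Defs
begin

text \<open>
  By independence, \<open>Z 1, \<dots>, Z m\<close> may be taken to be the coordinates of a product space. For a finitely
  valued \<open>Y\<close> on it and a set \<open>K\<close> of coordinates, let \<open>H(Y|K)\<close> be the conditional entropy of \<open>Y\<close>
  given the coordinates in \<open>K\<close>. Revealing the coordinates one at a time turns an entropy into a sum
  of conditional mutual informations,
  \<open>H(Y) = (\<Sum>i. I\<^sub>i(Y))\<close> with \<open>I\<^sub>i(Y) = H(Y|{1..i}) - H(Y|{1..Suc i})\<close>,
  because \<open>Y\<close> is determined once every coordinate is known. Two properties of \<open>I\<^sub>i\<close> suffice.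

  First, \<open>I\<^sub>i\<close> is monotone: if \<open>A\<close> is a function of \<open>B\<close>, then \<open>I\<^sub>i(A) \<le> I\<^sub>i(B)\<close>. Hence \<open>I\<^sub>i(X\<^sub>U)\<close> is
  nonnegative and at least \<open>I\<^sub>i(X\<^sub>v)\<close> for each \<open>v \<in> U\<close>. Secondly, \<open>I\<^sub>i(X\<^sub>v) = 0\<close> unless
  \<open>v \<in> W (Suc i)\<close>, because otherwise \<open>X\<^sub>v\<close> does not depend on the coordinate \<open>Suc i\<close> being revealed.

  The inequality for each fixed \<open>i\<close> is then a layer-cake argument (\<open>weighted_transversal_bound\<close>): the
  nonempty level sets \<open>S\<close> of \<open>v \<mapsto> I\<^sub>i(X\<^sub>v)\<close> are subsets of \<open>W (Suc i)\<close>, and the definition of \<open>beta\<close> says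
  that the sets \<open>U\<close> meeting \<open>S\<close> have total weight at least \<open>beta * card S\<close>. Summing over \<open>i\<close>
  gives the inequality.

  The monotonicity of \<open>I\<^sub>i\<close> (\<open>cond_entropy_compose_antimono\<close>) is Gibbs' inequality, applied
  pointwise to the conditional laws of \<open>B\<close> given \<open>A\<close> under the coarse and the fine conditioning, and
  then integrated. The values of the \<open>Z i\<close> are arbitrary, so conditional laws are described
  concretely: the coordinates outside \<open>K\<close> are resampled independently.

  For sharpness, take a minimising pair \<open>(i, S)\<close>, let \<open>Z i\<close> be a fair bit, let \<open>X v\<close> copy it for
  \<open>v \<in> S\<close> and let the other \<open>X v\<close> be constant. Each joint entropy is then one bit or zero, according
  to whether \<open>U\<close> meets \<open>S\<close>, and in units of bits the inequality reads \<open>c * card S \<le> (\<Sum>U | U \<inter> S \<noteq> {}. \<alpha> U)\<close>.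
\<close>

section \<open>Entropy inequalities for finite distributions\<close>

lemma xlnx_bounds:
  fixes t :: real
  assumes "0 \<le> t" "t \<le> 1"
  shows "0 \<le> - (t * ln t)" "- (t * ln t) \<le> 1"
proof -
  show "0 \<le> - (t * ln t)"
    using assms by (cases "t = 0") (auto simp: mult_le_0_iff)
  show "- (t * ln t) \<le> 1"
  proof (cases "t = 0")
    case False
    with assms have t: "t > 0" by simp
    then have "ln (1 / t) \<le> 1 / t - 1" by (intro ln_le_minus_one) simp
    then have "t * ln (1 / t) \<le> t * (1 / t - 1)" using t by (intro mult_left_mono) auto
    also have "\<dots> = 1 - t" using t by (simp add: field_simps)
    finally show ?thesis using t by (simp add: ln_div)
  qed simp
qed

text \<open>Here \<open>p x / P (\<phi> x)\<close> is the conditional probability of \<open>x\<close> given the value of \<open>\<phi>\<close>. On each fibre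
  of \<open>\<phi>\<close> the claim says that the relative entropy of the two conditional laws is nonnegative; weighting
  the fibres by \<open>P\<close> gives the sum.\<close>

lemma conditional_gibbs:
  fixes p q :: "'x \<Rightarrow> real" and \<phi> :: "'x \<Rightarrow> 'a"
  assumes "finite R" and p: "\<And>x. 0 \<le> p x" and q: "\<And>x. 0 \<le> q x"
    and ac: "\<And>x. x \<in> R \<Longrightarrow> q x = 0 \<Longrightarrow> p x = 0"
  defines "P \<equiv> \<lambda>a. \<Sum>x\<in>{x \<in> R. \<phi> x = a}. p x" and "Q \<equiv> \<lambda>a. \<Sum>x\<in>{x \<in> R. \<phi> x = a}. q x"
  shows "(\<Sum>x\<in>R. p x * ln (q x / Q (\<phi> x))) \<le> (\<Sum>x\<in>R. p x * ln (p x / P (\<phi> x)))"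
proof -
  have P0: "0 \<le> P a" and Q0: "0 \<le> Q a" for a unfolding P_def Q_def by (auto intro!: sum_nonneg p q)
  have pP: "p x \<le> P (\<phi> x)" and qQ: "q x \<le> Q (\<phi> x)" if "x \<in> R" for x
    unfolding P_def Q_def using that assms(1) by (auto intro!: member_le_sum p q)
  \<comment> \<open>From \<open>ln u \<le> u - 1\<close>. Where \<open>p x = 0\<close>, the left-hand term vanishes and the right-hand one is
    nonnegative; so the sum on the right runs over whole fibres, where the \<open>q x\<close> add up to \<open>Q a\<close>.\<close>
  have "(\<Sum>x\<in>R. p x * ln (q x / Q (\<phi> x)) - p x * ln (p x / P (\<phi> x)))
      \<le> (\<Sum>x\<in>R. P (\<phi> x) * (q x / Q (\<phi> x)) - p x)"
  proof (rule sum_mono)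
    fix x assume x: "x \<in> R"
    show "p x * ln (q x / Q (\<phi> x)) - p x * ln (p x / P (\<phi> x)) \<le> P (\<phi> x) * (q x / Q (\<phi> x)) - p x"
    proof (cases "p x = 0")
      case True
      then show ?thesis using P0 Q0 q by simp
    next
      case False
      then have pos: "p x > 0" "q x > 0" "P (\<phi> x) > 0" "Q (\<phi> x) > 0"
        using p[of x] q[of x] ac[OF x] pP[OF x] qQ[OF x] by fastforce+
      let ?t = "(q x / Q (\<phi> x)) / (p x / P (\<phi> x))"
      have "p x * ln (q x / Q (\<phi> x)) - p x * ln (p x / P (\<phi> x)) = p x * ln ?t"
        using pos by (simp add: ln_div ln_mult algebra_simps)
      also have "\<dots> \<le> p x * (?t - 1)"
        using pos by (intro mult_left_mono ln_le_minus_one) auto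
      also have "\<dots> = P (\<phi> x) * (q x / Q (\<phi> x)) - p x"
        using pos by (simp add: field_simps)
      finally show ?thesis .
    qed
  qed
  also have "\<dots> = (\<Sum>a\<in>\<phi> ` R. P a * (Q a / Q a)) - (\<Sum>a\<in>\<phi> ` R. P a)"
  proof -
    have "(\<Sum>x\<in>{x \<in> R. \<phi> x = a}. P (\<phi> x) * (q x / Q (\<phi> x))) = P a * (Q a / Q a)" for a
    proof -
      have "(\<Sum>x\<in>{x \<in> R. \<phi> x = a}. P (\<phi> x) * (q x / Q (\<phi> x)))
          = (\<Sum>x\<in>{x \<in> R. \<phi> x = a}. P a * (q x / Q a))"
        by (rule sum.cong) auto
      also have "\<dots> = P a * ((\<Sum>x\<in>{x \<in> R. \<phi> x = a}. q x) / Q a)"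
        by (simp only: sum_distrib_left sum_divide_distrib)
      finally show ?thesis by (simp only: Q_def)
    qed
    then have "(\<Sum>x\<in>R. P (\<phi> x) * (q x / Q (\<phi> x))) = (\<Sum>a\<in>\<phi> ` R. P a * (Q a / Q a))"
      by (simp only: sum.image_gen[OF assms(1), where g=\<phi>])
    moreover have "(\<Sum>x\<in>R. p x) = (\<Sum>a\<in>\<phi> ` R. P a)"
      unfolding P_def by (rule sum.image_gen[OF assms(1)])
    ultimately show ?thesis by (simp add: sum_subtractf)
  qed
  \<comment> \<open>\<open>Q a / Q a\<close> is 1 or, on fibres without \<open>q\<close>-mass, 0.\<close>
  also have "\<dots> \<le> 0"
    using P0 by (auto simp flip: sum_subtractf intro!: sum_nonpos)
  finally show ?thesis by (simp add: sum_subtractf)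
qed

text \<open>The entropy of a random element given its image under \<open>\<phi>\<close> is the difference of the two entropies.\<close>

lemma chain_rule_pointwise:
  fixes p :: "'x \<Rightarrow> real" and \<phi> :: "'x \<Rightarrow> 'a"
  assumes "finite R" and p: "\<And>x. 0 \<le> p x"
  defines "P \<equiv> \<lambda>a. \<Sum>x\<in>{x \<in> R. \<phi> x = a}. p x"
  shows "(\<Sum>x\<in>R. p x * ln (p x / P (\<phi> x))) = (\<Sum>x\<in>R. p x * ln (p x)) - (\<Sum>a\<in>\<phi> ` R. P a * ln (P a))"
proof -
  have "(\<Sum>x\<in>R. p x * ln (p x / P (\<phi> x))) = (\<Sum>x\<in>R. p x * ln (p x) - p x * ln (P (\<phi> x)))"
  proof (rule sum.cong[OF refl])
    fix x assume x: "x \<in> R"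
    have "p x \<le> P (\<phi> x)"
      unfolding P_def using x assms(1) by (auto intro!: member_le_sum p)
    then show "p x * ln (p x / P (\<phi> x)) = p x * ln (p x) - p x * ln (P (\<phi> x))"
      using p[of x] by (cases "p x = 0") (auto simp: ln_div right_diff_distrib)
  qed
  also have "(\<Sum>x\<in>R. p x * ln (P (\<phi> x))) = (\<Sum>a\<in>\<phi> ` R. P a * ln (P a))"
    unfolding sum.image_gen[OF assms(1), where g=\<phi>]
    by (intro sum.cong refl) (auto simp: P_def sum_distrib_right intro!: sum.cong)
  then have "(\<Sum>x\<in>R. p x * ln (p x) - p x * ln (P (\<phi> x)))
      = (\<Sum>x\<in>R. p x * ln (p x)) - (\<Sum>a\<in>\<phi> ` R. P a * ln (P a))"
    by (simp add: sum_subtractf)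
  finally show ?thesis .
qed

section \<open>Conditioning on some coordinates of a product space\<close>

context finite_product_prob_space
begin

abbreviation \<Omega> where "\<Omega> \<equiv> Pi\<^sub>M I M"

text \<open>The coordinates in \<open>K\<close> are kept from \<open>\<omega>\<close>, the others are taken from an independent copy \<open>y\<close>.\<close>

definition resample :: "'a set \<Rightarrow> ('a \<Rightarrow> 'b) \<Rightarrow> ('a \<Rightarrow> 'b) \<Rightarrow> 'a \<Rightarrow> 'b" where
  "resample K \<omega> y = (\<lambda>i\<in>I. if i \<in> K then \<omega> i else y i)"

lemma measurable_resample[measurable]:
  "(\<lambda>(\<omega>, y). resample K \<omega> y) \<in> \<Omega> \<Otimes>\<^sub>M \<Omega> \<rightarrow>\<^sub>M \<Omega>"
  unfolding resample_def case_prod_beta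
proof (rule measurable_restrict)
  fix i assume [measurable]: "i \<in> I"
  show "(\<lambda>z. if i \<in> K then fst z i else snd z i) \<in> \<Omega> \<Otimes>\<^sub>M \<Omega> \<rightarrow>\<^sub>M M i"
    by (cases "i \<in> K") simp_all
qed

lemma resample_in_space:
  "\<omega> \<in> space \<Omega> \<Longrightarrow> y \<in> space \<Omega> \<Longrightarrow> resample K \<omega> y \<in> space \<Omega>"
  by (auto simp: space_PiM resample_def)

text \<open>By independence of the coordinates, replacing some of them by an independent copy does not change
  the joint law.\<close>

lemma distr_resample:
  "distr (\<Omega> \<Otimes>\<^sub>M \<Omega>) \<Omega> (\<lambda>(\<omega>, y). resample K \<omega> y) = \<Omega>"
proof (rule PiM_eqI)
  fix A assume A: "\<And>i. i \<in> I \<Longrightarrow> A i \<in> sets (M i)"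
  let ?B = "\<lambda>i. if i \<in> K then A i else space (M i)"
  let ?C = "\<lambda>i. if i \<in> K then space (M i) else A i"
  have sub: "A i \<subseteq> space (M i)" if "i \<in> I" for i using A[OF that] by (rule sets.sets_into_space)
  have pre: "(\<lambda>(\<omega>, y). resample K \<omega> y) -` Pi\<^sub>E I A \<inter> space (\<Omega> \<Otimes>\<^sub>M \<Omega>) = Pi\<^sub>E I ?B \<times> Pi\<^sub>E I ?C"
  proof (rule set_eqI, clarify)
    fix \<omega> y :: "'a \<Rightarrow> 'b"
    have "resample K \<omega> y \<in> Pi\<^sub>E I A \<longleftrightarrow> (\<forall>i\<in>I. (if i \<in> K then \<omega> i else y i) \<in> A i)"
      by (auto simp: resample_def PiE_iff)
    moreover have "(if i \<in> K then \<omega> i else y i) \<in> A i \<and> \<omega> i \<in> space (M i) \<and> y i \<in> space (M i)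
        \<longleftrightarrow> \<omega> i \<in> ?B i \<and> y i \<in> ?C i" if "i \<in> I" for i
      using sub[OF that] by auto
    ultimately show "(\<omega>, y) \<in> (\<lambda>(\<omega>, y). resample K \<omega> y) -` Pi\<^sub>E I A \<inter> space (\<Omega> \<Otimes>\<^sub>M \<Omega>)
        \<longleftrightarrow> (\<omega>, y) \<in> Pi\<^sub>E I ?B \<times> Pi\<^sub>E I ?C"
      unfolding space_pair_measure space_PiM mem_Times_iff PiE_iff Int_iff vimage_eq fst_conv snd_conv prod.case
      by blast
  qed
  have [measurable]: "Pi\<^sub>E I A \<in> sets \<Omega>" "Pi\<^sub>E I ?B \<in> sets \<Omega>" "Pi\<^sub>E I ?C \<in> sets \<Omega>"
    using A by (auto intro!: sets_PiM_I_finite finite_index)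
  have "emeasure (distr (\<Omega> \<Otimes>\<^sub>M \<Omega>) \<Omega> (\<lambda>(\<omega>, y). resample K \<omega> y)) (Pi\<^sub>E I A)
      = emeasure \<Omega> (Pi\<^sub>E I ?B) * emeasure \<Omega> (Pi\<^sub>E I ?C)"
    by (subst emeasure_distr) (auto simp: pre emeasure_pair_measure_Times)
  also have "\<dots> = (\<Prod>i\<in>I. emeasure (M i) (?B i) * emeasure (M i) (?C i))"
    using A by (subst (1 2) emeasure_PiM) (auto simp: finite_index prod.distrib)
  also have "\<dots> = (\<Prod>i\<in>I. emeasure (M i) (A i))"
    by (intro prod.cong refl) (auto simp: M.emeasure_space_1)
  finally show "emeasure (distr (\<Omega> \<Otimes>\<^sub>M \<Omega>) \<Omega> (\<lambda>(\<omega>, y). resample K \<omega> y)) (Pi\<^sub>E I A)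
      = (\<Prod>i\<in>I. emeasure (M i) (A i))" .
qed (simp_all add: finite_index)

text \<open>As a function of \<open>\<omega>\<close>, this is a version of the conditional probability of \<open>Y = x\<close> given the
  coordinates in \<open>K\<close>. Fixing this version makes statements such as \<open>cond_dist_resample\<close>,
  \<open>cond_entropy_full\<close> and \<open>cond_entropy_irrelevant\<close> hold at every point, without null sets.\<close>

definition cond_dist :: "'a set \<Rightarrow> (('a \<Rightarrow> 'b) \<Rightarrow> 'x) \<Rightarrow> 'x \<Rightarrow> ('a \<Rightarrow> 'b) \<Rightarrow> real" where
  "cond_dist K Y x \<omega> = measure \<Omega> {y \<in> space \<Omega>. Y (resample K \<omega> y) = x}"

text \<open>Natural logarithms are used up to the final conversion to base \<open>b\<close>.\<close>

definition cond_entropy :: "'a set \<Rightarrow> (('a \<Rightarrow> 'b) \<Rightarrow> 'x) \<Rightarrow> real" where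
  "cond_entropy K Y = (\<integral>\<omega>. (\<Sum>x\<in>Y ` space \<Omega>. - (cond_dist K Y x \<omega> * ln (cond_dist K Y x \<omega>))) \<partial>\<Omega>)"

lemma cond_dist_nonneg: "0 \<le> cond_dist K Y x \<omega>"
  and cond_dist_le_1: "cond_dist K Y x \<omega> \<le> 1"
  unfolding cond_dist_def by auto

lemma fibre_sets:
  assumes "simple_function \<Omega> Y"
  shows "{(\<omega>, y). \<omega> \<in> space \<Omega> \<and> y \<in> space \<Omega> \<and> Y (resample K \<omega> y) = x} \<in> sets (\<Omega> \<Otimes>\<^sub>M \<Omega>)"
proof -
  have "Y -` {x} \<inter> space \<Omega> \<in> sets \<Omega>" by (rule simple_functionD[OF assms])
  from measurable_sets[OF measurable_resample this] show ?thesis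
    by (rule back_subst[of "\<lambda>A. A \<in> _"]) (auto simp: space_pair_measure intro: resample_in_space)
qed

lemma emeasure_cond_dist:
  "emeasure \<Omega> {y \<in> space \<Omega>. Y (resample K \<omega> y) = x} = ennreal (cond_dist K Y x \<omega>)"
  unfolding cond_dist_def by (simp add: P.emeasure_eq_measure)

lemma measurable_cond_dist:
  assumes "simple_function \<Omega> Y"
  shows "cond_dist K Y x \<in> borel_measurable \<Omega>"
proof -
  let ?S = "{(\<omega>, y). \<omega> \<in> space \<Omega> \<and> y \<in> space \<Omega> \<and> Y (resample K \<omega> y) = x}"
  have "(\<lambda>\<omega>. enn2real (emeasure \<Omega> (Pair \<omega> -` ?S))) \<in> borel_measurable \<Omega>"
    using measurable_emeasure_Pair[OF fibre_sets[OF assms]] by measurable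
  then show ?thesis
    by (rule measurable_cong[THEN iffD1, rotated])
      (auto simp: cond_dist_def measure_def intro!: arg_cong[where f="\<lambda>A. enn2real (emeasure \<Omega> A)"])
qed

text \<open>The defining property of a conditional probability. The hypothesis \<open>inv\<close> says that \<open>g\<close> depends only
  on the coordinates in \<open>K\<close>.\<close>

lemma nn_integral_cond_dist:
  fixes g :: "('a \<Rightarrow> 'b) \<Rightarrow> ennreal"
  assumes Y: "simple_function \<Omega> Y" and g[measurable]: "g \<in> borel_measurable \<Omega>"
    and inv: "\<And>\<omega> y. \<omega> \<in> space \<Omega> \<Longrightarrow> y \<in> space \<Omega> \<Longrightarrow> g (resample K \<omega> y) = g \<omega>"
  shows "(\<integral>\<^sup>+\<omega>. g \<omega> * ennreal (cond_dist K Y x \<omega>) \<partial>\<Omega>)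
    = (\<integral>\<^sup>+\<omega>. g \<omega> * indicator {\<omega> \<in> space \<Omega>. Y \<omega> = x} \<omega> \<partial>\<Omega>)"
proof -
  let ?E = "{\<omega> \<in> space \<Omega>. Y \<omega> = x}"
  have E[measurable]: "?E \<in> sets \<Omega>"
    using simple_functionD(2)[OF Y, of "{x}"] by (simp add: vimage_def Int_def conj_commute)
  have [measurable]: "(\<lambda>y. resample K \<omega> y) \<in> \<Omega> \<rightarrow>\<^sub>M \<Omega>" if "\<omega> \<in> space \<Omega>" for \<omega>
    using measurable_Pair2[OF measurable_resample that] by simp
  have "(\<integral>\<^sup>+\<omega>. g \<omega> * indicator ?E \<omega> \<partial>\<Omega>)
      = (\<integral>\<^sup>+\<omega>. g \<omega> * indicator ?E \<omega> \<partial>distr (\<Omega> \<Otimes>\<^sub>M \<Omega>) \<Omega> (\<lambda>(\<omega>, y). resample K \<omega> y))"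
    by (simp add: distr_resample)
  also have "\<dots> = (\<integral>\<^sup>+z. (case z of (\<omega>, y) \<Rightarrow> g (resample K \<omega> y) * indicator ?E (resample K \<omega> y)) \<partial>(\<Omega> \<Otimes>\<^sub>M \<Omega>))"
    by (subst nn_integral_distr) (auto simp: case_prod_beta intro!: nn_integral_cong)
  also have "\<dots> = (\<integral>\<^sup>+\<omega>. \<integral>\<^sup>+y. g (resample K \<omega> y) * indicator ?E (resample K \<omega> y) \<partial>\<Omega> \<partial>\<Omega>)"
  proof (subst nn_integral_fst[symmetric])
    have "(\<lambda>\<omega>. g \<omega> * indicator ?E \<omega>) \<in> borel_measurable \<Omega>" by measurable
    from measurable_comp[OF measurable_resample this]
    show "(\<lambda>(\<omega>, y). g (resample K \<omega> y) * indicator ?E (resample K \<omega> y)) \<in> borel_measurable (\<Omega> \<Otimes>\<^sub>M \<Omega>)"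
      by (simp add: comp_def case_prod_beta)
  qed simp
  also have "\<dots> = (\<integral>\<^sup>+\<omega>. g \<omega> * ennreal (cond_dist K Y x \<omega>) \<partial>\<Omega>)"
  proof (rule nn_integral_cong)
    fix \<omega> assume w[measurable]: "\<omega> \<in> space \<Omega>"
    have eq: "{y \<in> space \<Omega>. Y (resample K \<omega> y) = x} = (\<lambda>y. resample K \<omega> y) -` ?E \<inter> space \<Omega>"
      using w by (auto intro: resample_in_space)
    have S: "{y \<in> space \<Omega>. Y (resample K \<omega> y) = x} \<in> sets \<Omega>"
      unfolding eq using w by measurable
    have "(\<integral>\<^sup>+y. g (resample K \<omega> y) * indicator ?E (resample K \<omega> y) \<partial>\<Omega>)
        = (\<integral>\<^sup>+y. g \<omega> * indicator {y \<in> space \<Omega>. Y (resample K \<omega> y) = x} y \<partial>\<Omega>)"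
      using w by (intro nn_integral_cong) (auto simp: inv resample_in_space split: split_indicator)
    also have "\<dots> = g \<omega> * ennreal (cond_dist K Y x \<omega>)"
      using S by (simp add: nn_integral_cmult_indicator emeasure_cond_dist)
    finally show "(\<integral>\<^sup>+y. g (resample K \<omega> y) * indicator ?E (resample K \<omega> y) \<partial>\<Omega>)
        = g \<omega> * ennreal (cond_dist K Y x \<omega>)" .
  qed
  finally show ?thesis by simp
qed

lemma resample_resample: "K \<subseteq> K' \<Longrightarrow> resample K (resample K' \<omega> y) y' = resample K \<omega> y'"
  by (auto simp: resample_def fun_eq_iff)

lemma cond_dist_resample:
  "K \<subseteq> K' \<Longrightarrow> cond_dist K Y x (resample K' \<omega> y) = cond_dist K Y x \<omega>"
  by (simp add: cond_dist_def resample_resample)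

lemma cond_dist_compose:
  assumes B: "simple_function \<Omega> B" and w: "\<omega> \<in> space \<Omega>"
    and A: "\<And>\<omega>. \<omega> \<in> space \<Omega> \<Longrightarrow> A \<omega> = \<phi> (B \<omega>)"
  shows "cond_dist K A a \<omega> = (\<Sum>x\<in>{x \<in> B ` space \<Omega>. \<phi> x = a}. cond_dist K B x \<omega>)"
proof -
  let ?F = "\<lambda>x. {y \<in> space \<Omega>. B (resample K \<omega> y) = x}"
  have F: "?F x \<in> sets \<Omega>" for x
    using sets_Pair1[OF fibre_sets[OF B, of K x], of \<omega>] w by (simp add: vimage_def Collect_conj_eq)
  have "{y \<in> space \<Omega>. A (resample K \<omega> y) = a} = (\<Union>x\<in>{x \<in> B ` space \<Omega>. \<phi> x = a}. ?F x)"
    using w by (auto simp: A resample_in_space)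
  then show ?thesis
    unfolding cond_dist_def using F simple_functionD(1)[OF B]
    by (simp only:) (rule P.finite_measure_finite_Union, auto simp: disjoint_family_on_def)
qed

lemma integrable_xlnx:
  assumes "simple_function \<Omega> Y"
  shows "integrable \<Omega> (\<lambda>\<omega>. - (cond_dist K Y x \<omega> * ln (cond_dist K Y x \<omega>)))"
proof (rule P.integrable_const_bound[where B=1])
  have "norm (- (cond_dist K Y x \<omega> * ln (cond_dist K Y x \<omega>))) \<le> 1" for \<omega>
    using xlnx_bounds[OF cond_dist_nonneg cond_dist_le_1, of K Y x \<omega>] unfolding real_norm_def by linarith
  then show "AE \<omega> in \<Omega>. norm (- (cond_dist K Y x \<omega> * ln (cond_dist K Y x \<omega>))) \<le> 1"
    by blast
qed (use measurable_cond_dist[OF assms, of K x] in measurable)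

text \<open>Both sides equal the integral of \<open>g\<close> over the event \<open>Y = x\<close>: a function of the coordinates in \<open>K\<close>
  is also a function of those in \<open>K'\<close>.\<close>

lemma nn_integral_cond_dist_refine:
  fixes g :: "('a \<Rightarrow> 'b) \<Rightarrow> ennreal"
  assumes "simple_function \<Omega> Y" "g \<in> borel_measurable \<Omega>" "K \<subseteq> K'"
    and inv: "\<And>\<omega> y L. K \<subseteq> L \<Longrightarrow> \<omega> \<in> space \<Omega> \<Longrightarrow> y \<in> space \<Omega> \<Longrightarrow> g (resample L \<omega> y) = g \<omega>"
  shows "(\<integral>\<^sup>+\<omega>. g \<omega> * ennreal (cond_dist K Y x \<omega>) \<partial>\<Omega>)
    = (\<integral>\<^sup>+\<omega>. g \<omega> * ennreal (cond_dist K' Y x \<omega>) \<partial>\<Omega>)"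
  using assms(3) by (simp add: nn_integral_cond_dist[OF assms(1,2) inv])

text \<open>Gibbs' inequality requires that the fine conditional law vanishes wherever the coarse one does.
  This holds almost surely, since on the event that the coarse one vanishes both have the same integral.\<close>

lemma cond_dist_abs_cont:
  assumes Y: "simple_function \<Omega> Y" and KK: "K \<subseteq> K'"
  shows "AE \<omega> in \<Omega>. cond_dist K Y x \<omega> = 0 \<longrightarrow> cond_dist K' Y x \<omega> = 0"
proof -
  note [measurable] = measurable_cond_dist[OF Y]
  define g where "g \<omega> = (if cond_dist K Y x \<omega> = 0 then 1 else 0 :: ennreal)" for \<omega>
  have [measurable]: "g \<in> borel_measurable \<Omega>" unfolding g_def by measurable
  have "(\<integral>\<^sup>+\<omega>. g \<omega> * ennreal (cond_dist K' Y x \<omega>) \<partial>\<Omega>) = (\<integral>\<^sup>+\<omega>. g \<omega> * ennreal (cond_dist K Y x \<omega>) \<partial>\<Omega>)"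
    by (rule nn_integral_cond_dist_refine[OF Y _ KK, symmetric]) (auto simp: g_def cond_dist_resample)
  also have "\<dots> = (\<integral>\<^sup>+\<omega>. 0 \<partial>\<Omega>)"
    by (rule nn_integral_cong) (simp add: g_def)
  finally have "AE \<omega> in \<Omega>. g \<omega> * ennreal (cond_dist K' Y x \<omega>) = 0"
    by (subst nn_integral_0_iff_AE[symmetric]) auto
  then show ?thesis
    by eventually_elim (auto simp: g_def cond_dist_nonneg ennreal_eq_0_iff intro: antisym)
qed

text \<open>With \<open>A\<close> a function of \<open>B\<close>, the difference \<open>cond_entropy K B - cond_entropy K A\<close> is the entropy
  of \<open>B\<close> given both \<open>A\<close> and the coordinates in \<open>K\<close>, and knowing more coordinates can only decrease it.
  Write \<open>q\<close> and \<open>p\<close> for the conditional laws of \<open>B\<close> given \<open>K\<close> and given \<open>K'\<close>. The logarithm of the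
  conditional probability of \<open>B\<close> given \<open>A\<close> under \<open>q\<close> depends on the coordinates in \<open>K\<close> only, so in
  its integral the weights \<open>q\<close> may be replaced by \<open>p\<close>; then the pointwise Gibbs inequality applies.\<close>

lemma cond_entropy_compose_antimono:
  assumes B: "simple_function \<Omega> B" and A: "\<And>\<omega>. \<omega> \<in> space \<Omega> \<Longrightarrow> A \<omega> = \<phi> (B \<omega>)"
    and KK: "K \<subseteq> K'"
  shows "cond_entropy K' B - cond_entropy K' A \<le> cond_entropy K B - cond_entropy K A"
proof -
  let ?R = "B ` space \<Omega>"
  have R: "finite ?R" by (rule simple_functionD[OF B])
  have A_image: "A ` space \<Omega> = \<phi> ` ?R" using A by (auto simp: image_image)
  have As: "simple_function \<Omega> A"
    using simple_function_compose1[OF B, of \<phi>] simple_function_cong[of \<Omega> A "\<lambda>\<omega>. \<phi> (B \<omega>)"] A by (simp add: comp_def)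
  note [measurable] = measurable_cond_dist[OF B] measurable_cond_dist[OF As]
  let ?S = "\<lambda>L a \<omega>. \<Sum>x\<in>{x \<in> ?R. \<phi> x = a}. cond_dist L B x \<omega>"
  have comp: "cond_dist L A a \<omega> = ?S L a \<omega>" if "\<omega> \<in> space \<Omega>" for L a \<omega>
    by (rule cond_dist_compose[where A=A and \<phi>=\<phi>, OF B that A])
  have diff: "integrable \<Omega> (\<lambda>\<omega>. \<Sum>x\<in>?R. cond_dist L B x \<omega> * ln (cond_dist L B x \<omega> / cond_dist L A (\<phi> x) \<omega>))"
    "cond_entropy L B - cond_entropy L A
      = - (\<integral>\<omega>. (\<Sum>x\<in>?R. cond_dist L B x \<omega> * ln (cond_dist L B x \<omega> / cond_dist L A (\<phi> x) \<omega>)) \<partial>\<Omega>)" for L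
  proof -
    let ?f = "\<lambda>\<omega>. (\<Sum>x\<in>?R. - (cond_dist L B x \<omega> * ln (cond_dist L B x \<omega>)))
      - (\<Sum>a\<in>\<phi> ` ?R. - (cond_dist L A a \<omega> * ln (cond_dist L A a \<omega>)))"
    have int: "integrable \<Omega> ?f"
      by (intro Bochner_Integration.integrable_diff Bochner_Integration.integrable_sum integrable_xlnx B As)
    have eq: "(\<Sum>x\<in>?R. cond_dist L B x \<omega> * ln (cond_dist L B x \<omega> / cond_dist L A (\<phi> x) \<omega>)) = - ?f \<omega>"
      if "\<omega> \<in> space \<Omega>" for \<omega>
      using chain_rule_pointwise[OF R, of "\<lambda>x. cond_dist L B x \<omega>" \<phi>] that
      by (simp add: cond_dist_nonneg comp[OF that, symmetric] sum_negf)
    show "integrable \<Omega> (\<lambda>\<omega>. \<Sum>x\<in>?R. cond_dist L B x \<omega> * ln (cond_dist L B x \<omega> / cond_dist L A (\<phi> x) \<omega>))"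
      by (rule Bochner_Integration.integrable_cong[THEN iffD2, OF refl _ Bochner_Integration.integrable_minus[OF int]])
        (rule eq)
    have "cond_entropy L B - cond_entropy L A = (\<integral>\<omega>. ?f \<omega> \<partial>\<Omega>)"
      unfolding cond_entropy_def A_image
      by (rule Bochner_Integration.integral_diff[symmetric])
        (intro Bochner_Integration.integrable_sum integrable_xlnx B As)+
    also have "\<dots> = (\<integral>\<omega>. - (\<Sum>x\<in>?R. cond_dist L B x \<omega> * ln (cond_dist L B x \<omega> / cond_dist L A (\<phi> x) \<omega>)) \<partial>\<Omega>)"
      by (rule Bochner_Integration.integral_cong) (simp_all add: eq)
    finally show "cond_entropy L B - cond_entropy L A
      = - (\<integral>\<omega>. (\<Sum>x\<in>?R. cond_dist L B x \<omega> * ln (cond_dist L B x \<omega> / cond_dist L A (\<phi> x) \<omega>)) \<partial>\<Omega>)"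
      by simp
  qed
  \<comment> \<open>The function \<open>g x\<close> may be unbounded. Exchanging the weights therefore takes place for nonnegative
    integrals, and integrability follows from the bound on \<open>q * g x\<close>.\<close>
  define g where "g x \<omega> = - ln (cond_dist K B x \<omega> / cond_dist K A (\<phi> x) \<omega>)" for x \<omega>
  have le: "cond_dist K B x \<omega> \<le> cond_dist K A (\<phi> x) \<omega>" if "\<omega> \<in> space \<Omega>" "x \<in> ?R" for x \<omega>
    unfolding comp[OF that(1)]
    using R that(2) by (auto intro!: member_le_sum cond_dist_nonneg)
  have g0: "0 \<le> g x \<omega>" if "\<omega> \<in> space \<Omega>" "x \<in> ?R" for x \<omega>
  proof (cases "cond_dist K B x \<omega> = 0")
    case False
    then have "0 < cond_dist K B x \<omega>" using cond_dist_nonneg[of K B x \<omega>] by linarith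
    then show ?thesis
      using le[OF that] unfolding g_def by (subst neg_0_le_iff_le, subst ln_le_zero_iff) auto
  qed (simp add: g_def)
  have [measurable]: "g x \<in> borel_measurable \<Omega>" for x unfolding g_def by measurable
  have bound: "cond_dist K B x \<omega> * g x \<omega> \<le> 1" if "\<omega> \<in> space \<Omega>" "x \<in> ?R" for x \<omega>
  proof -
    let ?q = "cond_dist K B x \<omega>" and ?Q = "cond_dist K A (\<phi> x) \<omega>"
    have "?q * g x \<omega> = ?Q * - (?q / ?Q * ln (?q / ?Q))"
      using le[OF that] cond_dist_nonneg[of K B x \<omega>] by (cases "?Q = 0") (auto simp: g_def)
    also have "\<dots> \<le> 1 * 1"
      using le[OF that] cond_dist_nonneg[of K B x \<omega>] cond_dist_nonneg[of K A "\<phi> x" \<omega>]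
      by (intro mult_mono xlnx_bounds cond_dist_le_1) (auto simp: divide_le_eq_1)
    finally show ?thesis by simp
  qed
  have nn: "(\<integral>\<^sup>+\<omega>. ennreal (cond_dist K' B x \<omega> * g x \<omega>) \<partial>\<Omega>) = (\<integral>\<^sup>+\<omega>. ennreal (cond_dist K B x \<omega> * g x \<omega>) \<partial>\<Omega>)"
    if x: "x \<in> ?R" for x
  proof -
    have "(\<integral>\<^sup>+\<omega>. ennreal (g x \<omega>) * ennreal (cond_dist K B x \<omega>) \<partial>\<Omega>)
        = (\<integral>\<^sup>+\<omega>. ennreal (g x \<omega>) * ennreal (cond_dist K' B x \<omega>) \<partial>\<Omega>)"
      by (rule nn_integral_cond_dist_refine[OF B _ KK]) (auto simp: g_def cond_dist_resample)
    then show ?thesis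
      by (simp add: ennreal_mult'' cond_dist_nonneg mult.commute)
  qed
  have intK: "integrable \<Omega> (\<lambda>\<omega>. cond_dist K B x \<omega> * g x \<omega>)" if "x \<in> ?R" for x
    using that by (intro P.integrable_const_bound[where B=1])
      (auto simp: abs_mult cond_dist_nonneg g0 bound)
  have intK': "integrable \<Omega> (\<lambda>\<omega>. cond_dist K' B x \<omega> * g x \<omega>)"
    and eqK: "(\<integral>\<omega>. cond_dist K' B x \<omega> * g x \<omega> \<partial>\<Omega>) = (\<integral>\<omega>. cond_dist K B x \<omega> * g x \<omega> \<partial>\<Omega>)" if x: "x \<in> ?R" for x
  proof -
    have fin: "(\<integral>\<^sup>+\<omega>. ennreal (cond_dist K B x \<omega> * g x \<omega>) \<partial>\<Omega>) < \<infinity>"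
      using intK[OF x] x by (subst nn_integral_eq_integral) (auto simp: cond_dist_nonneg g0)
    show "integrable \<Omega> (\<lambda>\<omega>. cond_dist K' B x \<omega> * g x \<omega>)"
      using fin x nn[OF x] by (intro integrableI_nonneg) (auto simp: cond_dist_nonneg g0)
    show "(\<integral>\<omega>. cond_dist K' B x \<omega> * g x \<omega> \<partial>\<Omega>) = (\<integral>\<omega>. cond_dist K B x \<omega> * g x \<omega> \<partial>\<Omega>)"
      using x nn[OF x] by (subst (1 2) integral_eq_nn_integral) (auto simp: cond_dist_nonneg g0)
  qed
  \<comment> \<open>The chain from the coarse conditioning to the fine one: exchange of weights, then Gibbs.\<close>
  have "(\<integral>\<omega>. (\<Sum>x\<in>?R. cond_dist K B x \<omega> * ln (cond_dist K B x \<omega> / cond_dist K A (\<phi> x) \<omega>)) \<partial>\<Omega>)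
      = - (\<Sum>x\<in>?R. \<integral>\<omega>. cond_dist K B x \<omega> * g x \<omega> \<partial>\<Omega>)"
    using intK by (subst Bochner_Integration.integral_sum[symmetric])
      (auto simp: g_def sum_negf)
  also have "\<dots> = - (\<Sum>x\<in>?R. \<integral>\<omega>. cond_dist K' B x \<omega> * g x \<omega> \<partial>\<Omega>)"
    by (simp add: eqK cong: sum.cong)
  also have "\<dots> = (\<integral>\<omega>. - (\<Sum>x\<in>?R. cond_dist K' B x \<omega> * g x \<omega>) \<partial>\<Omega>)"
    using intK' by (subst Bochner_Integration.integral_sum[symmetric]) auto
  also have "\<dots> \<le> (\<integral>\<omega>. (\<Sum>x\<in>?R. cond_dist K' B x \<omega> * ln (cond_dist K' B x \<omega> / cond_dist K' A (\<phi> x) \<omega>)) \<partial>\<Omega>)"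
  proof (rule integral_mono_AE)
    have "AE \<omega> in \<Omega>. \<forall>x\<in>?R. cond_dist K B x \<omega> = 0 \<longrightarrow> cond_dist K' B x \<omega> = 0"
      using R by (intro AE_finite_allI cond_dist_abs_cont[OF B KK])
    then show "AE \<omega> in \<Omega>. - (\<Sum>x\<in>?R. cond_dist K' B x \<omega> * g x \<omega>)
        \<le> (\<Sum>x\<in>?R. cond_dist K' B x \<omega> * ln (cond_dist K' B x \<omega> / cond_dist K' A (\<phi> x) \<omega>))"
      using AE_space
    proof eventually_elim
      case (elim \<omega>)
      have "(\<Sum>x\<in>?R. cond_dist K' B x \<omega> * ln (cond_dist K B x \<omega> / ?S K (\<phi> x) \<omega>))
          \<le> (\<Sum>x\<in>?R. cond_dist K' B x \<omega> * ln (cond_dist K' B x \<omega> / ?S K' (\<phi> x) \<omega>))"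
        using elim by (intro conditional_gibbs[OF R]) (auto simp: cond_dist_nonneg)
      then show ?case
        unfolding g_def by (simp add: comp[OF elim(2)] sum_negf)
    qed
  qed (use intK' diff(1) in auto)
  finally show ?thesis unfolding diff(2) by simp
qed

lemma cond_entropy_empty:
  "cond_entropy {} Y = (\<Sum>x\<in>Y ` space \<Omega>. - (measure \<Omega> {y \<in> space \<Omega>. Y y = x} * ln (measure \<Omega> {y \<in> space \<Omega>. Y y = x})))"
proof -
  have "{y \<in> space \<Omega>. Y (resample {} \<omega> y) = x} = {y \<in> space \<Omega>. Y y = x}" for \<omega> x
    by (auto simp: resample_def space_PiM PiE_restrict)
  then show ?thesis
    by (simp add: cond_entropy_def cond_dist_def P.prob_space)
qed

lemma cond_entropy_full:
  assumes "I \<subseteq> K"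
  shows "cond_entropy K Y = 0"
proof -
  have "{y \<in> space \<Omega>. Y (resample K \<omega> y) = x} = (if Y \<omega> = x then space \<Omega> else {})" if "\<omega> \<in> space \<Omega>" for \<omega> x
  proof -
    have "resample K \<omega> y = \<omega>" for y
      using that assms by (auto simp: resample_def space_PiM PiE_iff extensional_def fun_eq_iff)
    then show ?thesis by auto
  qed
  then have "cond_dist K Y x \<omega> * ln (cond_dist K Y x \<omega>) = 0" if "\<omega> \<in> space \<Omega>" for \<omega> x
    using that by (simp add: cond_dist_def P.prob_space)
  then have "(\<Sum>x\<in>Y ` space \<Omega>. - (cond_dist K Y x \<omega> * ln (cond_dist K Y x \<omega>))) = 0" if "\<omega> \<in> space \<Omega>" for \<omega>
    using that by (intro sum.neutral) (simp del: mult_eq_0_iff)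
  then show ?thesis
    unfolding cond_entropy_def by (simp cong: Bochner_Integration.integral_cong)
qed

lemma cond_entropy_irrelevant:
  assumes "\<And>\<omega> y. \<omega> \<in> space \<Omega> \<Longrightarrow> y \<in> space \<Omega> \<Longrightarrow> Y (resample K \<omega> y) = Y (resample K' \<omega> y)"
  shows "cond_entropy K Y = cond_entropy K' Y"
  unfolding cond_entropy_def cond_dist_def
  by (rule Bochner_Integration.integral_cong[OF refl]) (simp add: assms cong: conj_cong)

lemma cond_entropy_const: "cond_entropy K (\<lambda>_. c) = 0"
  by (simp add: cond_entropy_def cond_dist_def P.prob_space P.not_empty image_constant_conv cong: conj_cong)

lemma cond_entropy_antimono:
  assumes "simple_function \<Omega> Y" "K \<subseteq> K'"
  shows "cond_entropy K' Y \<le> cond_entropy K Y"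
  using cond_entropy_compose_antimono[OF assms(1) _ assms(2), of "\<lambda>_. ()" "\<lambda>_. ()"]
  by (simp add: cond_entropy_const)

text \<open>The mutual information between \<open>Y\<close> and the coordinates in \<open>K' - K\<close>, given those in \<open>K\<close>.\<close>

definition cond_information :: "'a set \<Rightarrow> 'a set \<Rightarrow> (('a \<Rightarrow> 'b) \<Rightarrow> 'x) \<Rightarrow> real" where
  "cond_information K K' Y = cond_entropy K Y - cond_entropy K' Y"

lemma cond_information_nonneg:
  "simple_function \<Omega> Y \<Longrightarrow> K \<subseteq> K' \<Longrightarrow> 0 \<le> cond_information K K' Y"
  using cond_entropy_antimono by (simp add: cond_information_def)

lemma cond_information_mono:
  assumes "simple_function \<Omega> B" and "\<And>\<omega>. \<omega> \<in> space \<Omega> \<Longrightarrow> A \<omega> = \<phi> (B \<omega>)" and "K \<subseteq> K'"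
  shows "cond_information K K' A \<le> cond_information K K' B"
  using cond_entropy_compose_antimono[where \<phi>=\<phi>, OF assms] by (simp add: cond_information_def)

text \<open>The sum telescopes, and no uncertainty is left once all coordinates are known.\<close>

lemma cond_entropy_empty_eq_sum_information:
  assumes "I \<subseteq> K m" and "K 0 = {}"
  shows "cond_entropy {} Y = (\<Sum>i<m. cond_information (K i) (K (Suc i)) Y)"
  using sum_lessThan_telescope'[of "\<lambda>i. cond_entropy (K i) Y" m] assms
  by (simp add: cond_information_def cond_entropy_full)

end

section \<open>Weighted families of sets meeting every level set\<close>

text \<open>The function \<open>h\<close> is a positive combination of indicators of its level sets \<open>S\<close>, and \<open>G\<close> dominates
  \<open>t\<close> on every \<open>U\<close> that meets the level set at height \<open>t\<close>. The induction peels off the lowest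
  level: subtracting the least positive value of \<open>h\<close> from \<open>h\<close> on its support, and from \<open>G\<close> on the sets
  that meet the support, keeps all hypotheses and shrinks the support.\<close>

lemma weighted_transversal_bound:
  fixes h :: "'v \<Rightarrow> real" and G :: "'v set \<Rightarrow> real"
  assumes "finite V" and "T \<subseteq> V"
    and \<alpha>: "\<And>U. U \<subseteq> V \<Longrightarrow> 0 \<le> \<alpha> U"
    and cover: "\<And>S. S \<subseteq> T \<Longrightarrow> S \<noteq> {} \<Longrightarrow> \<beta> * real (card S) \<le> (\<Sum>U\<in>{U. U \<subseteq> V \<and> U \<inter> S \<noteq> {}}. \<alpha> U)"
    and "\<And>v. v \<in> V \<Longrightarrow> 0 \<le> h v" and "\<And>v. v \<in> V - T \<Longrightarrow> h v = 0"
    and "\<And>U. U \<subseteq> V \<Longrightarrow> 0 \<le> G U" and "\<And>U v. U \<subseteq> V \<Longrightarrow> v \<in> U \<Longrightarrow> h v \<le> G U"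
  shows "\<beta> * (\<Sum>v\<in>V. h v) \<le> (\<Sum>U\<in>Pow V. \<alpha> U * G U)"
  using assms(5-8)
proof (induction "card {v \<in> V. h v \<noteq> 0}" arbitrary: h G rule: less_induct)
  case less
  let ?S = "{v \<in> V. h v \<noteq> 0}"
  have S: "finite ?S" "?S \<subseteq> T" using \<open>finite V\<close> less.prems(2) by auto
  show ?case
  proof (cases "?S = {}")
    case True
    then have "(\<Sum>v\<in>V. h v) = 0" by (intro sum.neutral) auto
    then show ?thesis
      using \<alpha> less.prems(3) by (auto intro!: sum_nonneg)
  next
    case False
    define t where "t = Min (h ` ?S)"
    have t_le: "t \<le> h v" if "v \<in> ?S" for v
      unfolding t_def using S(1) that by auto
    have "t \<in> h ` ?S"
      unfolding t_def using S(1) False by (intro Min_in) auto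
    then obtain w where w: "w \<in> ?S" "h w = t" by auto
    have t: "0 \<le> t" using w less.prems(1) by auto
    define h' where "h' v = h v - (if v \<in> ?S then t else 0)" for v
    define G' where "G' U = G U - (if U \<inter> ?S \<noteq> {} then t else 0)" for U
    have "{v \<in> V. h' v \<noteq> 0} \<subset> ?S"
      using w by (auto simp: h'_def)
    then have "card {v \<in> V. h' v \<noteq> 0} < card ?S"
      using S(1) by (rule psubset_card_mono[rotated])
    then have IH: "\<beta> * (\<Sum>v\<in>V. h' v) \<le> (\<Sum>U\<in>Pow V. \<alpha> U * G' U)"
    proof (rule less.hyps)
      show "0 \<le> h' v" if "v \<in> V" for v
        using t_le[of v] less.prems(1)[OF that] by (auto simp: h'_def)
      show "h' v = 0" if "v \<in> V - T" for v
        using less.prems(2)[OF that] by (simp add: h'_def)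
      show G'0: "0 \<le> G' U" if U: "U \<subseteq> V" for U
      proof (cases "U \<inter> ?S = {}")
        case False
        then obtain v where "v \<in> U" "v \<in> ?S" by auto
        then show ?thesis
          using t_le[of v] less.prems(4)[OF U, of v] False by (simp add: G'_def)
      qed (simp add: G'_def less.prems(3)[OF U])
      show "h' v \<le> G' U" if U: "U \<subseteq> V" "v \<in> U" for U v
      proof (cases "v \<in> ?S")
        case True
        with U have "U \<inter> ?S \<noteq> {}" by auto
        then show ?thesis using True less.prems(4)[OF U] by (simp add: h'_def G'_def)
      next
        case False
        then have "h' v = 0" using U by (auto simp: h'_def)
        then show ?thesis using G'0[OF U(1)] by simp
      qed
    qed
    have "\<beta> * (\<Sum>v\<in>V. h v) = \<beta> * (\<Sum>v\<in>V. h' v) + t * (\<beta> * real (card ?S))"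
    proof -
      have "(\<Sum>v\<in>V. if v \<in> ?S then t else 0) = real (card ?S) * t"
        using \<open>finite V\<close> by (subst sum.inter_filter[symmetric]) auto
      then show ?thesis by (simp add: h'_def sum_subtractf algebra_simps)
    qed
    also have "\<dots> \<le> (\<Sum>U\<in>Pow V. \<alpha> U * G' U) + t * (\<Sum>U\<in>{U. U \<subseteq> V \<and> U \<inter> ?S \<noteq> {}}. \<alpha> U)"
      using IH t cover[OF S(2) False] by (intro add_mono mult_left_mono)
    also have "t * (\<Sum>U\<in>{U. U \<subseteq> V \<and> U \<inter> ?S \<noteq> {}}. \<alpha> U) = (\<Sum>U\<in>Pow V. \<alpha> U * (if U \<inter> ?S \<noteq> {} then t else 0))"
    proof -
      have "{U. U \<subseteq> V \<and> U \<inter> ?S \<noteq> {}} = {U \<in> Pow V. U \<inter> ?S \<noteq> {}}" by auto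
      then show ?thesis
        using \<open>finite V\<close> by (simp only:) (subst sum.inter_filter, auto simp: sum_distrib_left intro!: sum.cong)
    qed
    also have "(\<Sum>U\<in>Pow V. \<alpha> U * G' U) + \<dots> = (\<Sum>U\<in>Pow V. \<alpha> U * G U)"
      by (simp add: G'_def algebra_simps flip: sum.distrib cong: sum.cong)
    finally show ?thesis .
  qed
qed

section \<open>The inequality on a product space\<close>

lemma joint_insert: "joint X (insert v U) \<omega> = (joint X U \<omega>)(v := X v \<omega>)"
  by (auto simp: joint_def)

lemma simple_function_joint:
  assumes "finite U" and "\<And>v. v \<in> U \<Longrightarrow> simple_function M (X v)"
  shows "simple_function M (joint X U)"
  using assms
proof (induction U rule: finite_induct)
  case empty
  then show ?case by (simp add: joint_def)
next
  case (insert v U)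
  then have "simple_function M (joint X U)" "simple_function M (X v)" by auto
  from simple_function_compose2[OF this, of "\<lambda>g x. g(v := x)"]
  have "simple_function M (\<lambda>\<omega>. (joint X U \<omega>)(v := X v \<omega>))" .
  also have "(\<lambda>\<omega>. (joint X U \<omega>)(v := X v \<omega>)) = joint X (insert v U)"
    by (rule ext) (rule joint_insert[symmetric])
  finally show ?case .
qed

text \<open>Revealing coordinate \<open>Suc i\<close> gives no information about \<open>X v\<close> unless \<open>v \<in> W (Suc i)\<close>; this is what
  \<open>local\<close> provides, and it confines the level sets at step \<open>i\<close> to \<open>W (Suc i)\<close>.\<close>

lemma weighted_entropy_bound_product:
  fixes X :: "'v \<Rightarrow> (nat \<Rightarrow> 'z) \<Rightarrow> 'x"
  assumes "finite_product_prob_space D {1..m}"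
    and "finite V" and W: "\<And>i. i \<in> {1..m} \<Longrightarrow> W i \<subseteq> V"
    and \<alpha>: "\<And>U. U \<subseteq> V \<Longrightarrow> 0 \<le> \<alpha> U"
    and cover: "\<And>i S. i \<in> {1..m} \<Longrightarrow> S \<subseteq> W i \<Longrightarrow> S \<noteq> {} \<Longrightarrow>
      \<beta> * real (card S) \<le> (\<Sum>U\<in>{U. U \<subseteq> V \<and> U \<inter> S \<noteq> {}}. \<alpha> U)"
    and X: "\<And>v. v \<in> V \<Longrightarrow> simple_function (Pi\<^sub>M {1..m} D) (X v)"
    and local: "\<And>v \<omega> \<omega>'. v \<in> V \<Longrightarrow> (\<And>i. i \<in> {1..m} \<Longrightarrow> v \<in> W i \<Longrightarrow> \<omega> i = \<omega>' i) \<Longrightarrow> X v \<omega> = X v \<omega>'"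
  shows "\<beta> * (\<Sum>v\<in>V. finite_product_prob_space.cond_entropy D {1..m} {} (X v))
    \<le> (\<Sum>U\<in>Pow V. \<alpha> U * finite_product_prob_space.cond_entropy D {1..m} {} (joint X U))"
proof -
  interpret finite_product_prob_space D "{1..m}" by fact
  have J: "simple_function \<Omega> (joint X U)" if "U \<subseteq> V" for U
    using that X \<open>finite V\<close> by (intro simple_function_joint) (auto dest: finite_subset)
  have sub: "{1..i} \<subseteq> {1..Suc i}" for i :: nat by auto
  have step: "\<beta> * (\<Sum>v\<in>V. cond_information {1..i} {1..Suc i} (X v))
      \<le> (\<Sum>U\<in>Pow V. \<alpha> U * cond_information {1..i} {1..Suc i} (joint X U))" if i: "i < m" for i
  proof (rule weighted_transversal_bound[OF \<open>finite V\<close> _ \<alpha>])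
    from i have i': "Suc i \<in> {1..m}" by auto
    show "W (Suc i) \<subseteq> V" by (rule W[OF i'])
    show "\<beta> * real (card S) \<le> (\<Sum>U\<in>{U. U \<subseteq> V \<and> U \<inter> S \<noteq> {}}. \<alpha> U)" if "S \<subseteq> W (Suc i)" "S \<noteq> {}" for S
      by (rule cover[OF i' that])
    show "0 \<le> cond_information {1..i} {1..Suc i} (X v)" if "v \<in> V" for v
      by (rule cond_information_nonneg[OF X[OF that] sub])
    show "0 \<le> cond_information {1..i} {1..Suc i} (joint X U)" if "U \<subseteq> V" for U
      by (rule cond_information_nonneg[OF J[OF that] sub])
    show "cond_information {1..i} {1..Suc i} (X v) = 0" if v: "v \<in> V - W (Suc i)" for v
    proof -
      have "X v (resample {1..i} \<omega> y) = X v (resample {1..Suc i} \<omega> y)" for \<omega> y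
        using v unfolding resample_def by (intro local) (auto simp: le_Suc_eq)
      then have "cond_entropy {1..i} (X v) = cond_entropy {1..Suc i} (X v)"
        by (rule cond_entropy_irrelevant)
      then show ?thesis unfolding cond_information_def by simp
    qed
    show "cond_information {1..i} {1..Suc i} (X v) \<le> cond_information {1..i} {1..Suc i} (joint X U)"
      if "U \<subseteq> V" "v \<in> U" for U v
    proof -
      have "X v \<omega> = joint X U \<omega> v" for \<omega> using that(2) by (simp add: joint_def)
      from cond_information_mono[where \<phi>="\<lambda>x. x v", OF J[OF that(1)] this sub] show ?thesis .
    qed
  qed
  have chain: "cond_entropy {} Y = (\<Sum>i<m. cond_information {1..i} {1..Suc i} Y)" for Y :: "(nat \<Rightarrow> 'z) \<Rightarrow> 'y"
    by (rule cond_entropy_empty_eq_sum_information) auto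
  have "\<beta> * (\<Sum>v\<in>V. cond_entropy {} (X v)) = (\<Sum>i<m. \<beta> * (\<Sum>v\<in>V. cond_information {1..i} {1..Suc i} (X v)))"
    unfolding chain by (subst sum.swap) (simp only: sum_distrib_left)
  also have "\<dots> \<le> (\<Sum>i<m. \<Sum>U\<in>Pow V. \<alpha> U * cond_information {1..i} {1..Suc i} (joint X U))"
    using step by (intro sum_mono) auto
  also have "\<dots> = (\<Sum>U\<in>Pow V. \<alpha> U * cond_entropy {} (joint X U))"
    unfolding chain by (subst sum.swap) (simp only: sum_distrib_left)
  finally show ?thesis .
qed

section \<open>Transfer to arbitrary independent random variables\<close>

context finite_product_prob_space
begin

text \<open>A value that \<open>Y\<close> attains but \<open>X\<close> does not has probability zero, so summing over the
  possibly larger set of values of \<open>Y\<close> makes no difference.\<close>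

lemma entropy_eq_cond_entropy_empty:
  assumes "prob_space Q" and "b > 1" and \<zeta>: "\<zeta> \<in> Q \<rightarrow>\<^sub>M \<Omega>" "distr Q \<Omega> \<zeta> = \<Omega>"
    and Y: "simple_function \<Omega> Y" and X: "\<And>\<omega>. \<omega> \<in> space Q \<Longrightarrow> X \<omega> = Y (\<zeta> \<omega>)"
  shows "H Q b X = cond_entropy {} Y / ln b"
proof -
  interpret Q: information_space Q b
    using assms(1,2) by (simp add: information_space_def information_space_axioms_def)
  have sX: "simple_function Q X"
    using simple_function_comp[OF \<zeta>(1) Y] simple_function_cong[of Q X "Y \<circ> \<zeta>"] X by (simp add: comp_def)
  have p: "measure Q (X -` {x} \<inter> space Q) = measure \<Omega> {y \<in> space \<Omega>. Y y = x}" for x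
  proof -
    have E: "{y \<in> space \<Omega>. Y y = x} \<in> sets \<Omega>"
      using simple_functionD(2)[OF Y, of "{x}"] by (simp add: vimage_def Int_def conj_commute)
    have "measure \<Omega> {y \<in> space \<Omega>. Y y = x} = measure (distr Q \<Omega> \<zeta>) {y \<in> space \<Omega>. Y y = x}"
      by (simp add: \<zeta>(2))
    also have "\<dots> = measure Q (\<zeta> -` {y \<in> space \<Omega>. Y y = x} \<inter> space Q)"
      using measure_distr[OF \<zeta>(1) E] .
    also have "\<zeta> -` {y \<in> space \<Omega>. Y y = x} \<inter> space Q = X -` {x} \<inter> space Q"
      using measurable_space[OF \<zeta>(1)] X by auto
    finally show ?thesis by simp
  qed
  have "H Q b X = (\<Sum>x\<in>X ` space Q. - (measure Q (X -` {x} \<inter> space Q) * ln (measure Q (X -` {x} \<inter> space Q)))) / ln b"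
    by (subst H_eq_sum[OF Q.information_space_axioms sX])
      (simp add: log_def sum_divide_distrib sum_negf)
  also have "(\<Sum>x\<in>X ` space Q. - (measure Q (X -` {x} \<inter> space Q) * ln (measure Q (X -` {x} \<inter> space Q))))
      = (\<Sum>x\<in>Y ` space \<Omega>. - (measure Q (X -` {x} \<inter> space Q) * ln (measure Q (X -` {x} \<inter> space Q))))"
  proof (rule sum.mono_neutral_left)
    show "finite (Y ` space \<Omega>)" by (rule simple_functionD[OF Y])
    show "X ` space Q \<subseteq> Y ` space \<Omega>" using measurable_space[OF \<zeta>(1)] X by auto
    have "X -` {x} \<inter> space Q = {}" if "x \<notin> X ` space Q" for x using that by auto
    then show "\<forall>x\<in>Y ` space \<Omega> - X ` space Q. - (measure Q (X -` {x} \<inter> space Q) * ln (measure Q (X -` {x} \<inter> space Q))) = 0"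
      by simp
  qed
  also have "\<dots> = cond_entropy {} Y"
    by (simp add: p cond_entropy_empty)
  finally show ?thesis .
qed

end

lemma beta_candidates_finite:
  assumes "finite V" and W: "\<And>i. i \<in> {1..m} \<Longrightarrow> W i \<subseteq> V"
  shows "finite {(\<Sum>U\<in>{U. U \<subseteq> V \<and> U \<inter> S \<noteq> {}}. \<alpha> U) / real (card S) | i S.
           i \<in> {1..m} \<and> S \<subseteq> W i \<and> S \<noteq> {}}"
proof (rule finite_subset)
  show "{(\<Sum>U\<in>{U. U \<subseteq> V \<and> U \<inter> S \<noteq> {}}. \<alpha> U) / real (card S) | i S. i \<in> {1..m} \<and> S \<subseteq> W i \<and> S \<noteq> {}}
    \<subseteq> (\<lambda>S. (\<Sum>U\<in>{U. U \<subseteq> V \<and> U \<inter> S \<noteq> {}}. \<alpha> U) / real (card S)) ` Pow V"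
    using W by blast
qed (use assms(1) in simp)

lemma beta_le:
  assumes "finite V" and W: "\<And>i. i \<in> {1..m} \<Longrightarrow> W i \<subseteq> V"
    and i: "i \<in> {1..m}" "S \<subseteq> W i" "S \<noteq> {}"
  shows "beta V m W \<alpha> * real (card S) \<le> (\<Sum>U\<in>{U. U \<subseteq> V \<and> U \<inter> S \<noteq> {}}. \<alpha> U)"
proof -
  have "finite S" using assms by (meson finite_subset)
  then have pos: "real (card S) > 0" using i(3) by (simp add: card_gt_0_iff)
  have "beta V m W \<alpha> \<le> (\<Sum>U\<in>{U. U \<subseteq> V \<and> U \<inter> S \<noteq> {}}. \<alpha> U) / real (card S)"
    unfolding beta_def using i by (intro Min_le[OF beta_candidates_finite[OF assms(1) W]]) blast+
  then show ?thesis using pos by (simp add: pos_le_divide_eq)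
qed

lemma beta_attained:
  assumes "finite V" and W: "\<And>i. i \<in> {1..m} \<Longrightarrow> W i \<subseteq> V" and "\<exists>i\<in>{1..m}. W i \<noteq> {}"
  obtains i S where "i \<in> {1..m}" "S \<subseteq> W i" "S \<noteq> {}"
    "beta V m W \<alpha> = (\<Sum>U\<in>{U. U \<subseteq> V \<and> U \<inter> S \<noteq> {}}. \<alpha> U) / real (card S)"
proof -
  have "beta V m W \<alpha> \<in> {(\<Sum>U\<in>{U. U \<subseteq> V \<and> U \<inter> S \<noteq> {}}. \<alpha> U) / real (card S) | i S.
           i \<in> {1..m} \<and> S \<subseteq> W i \<and> S \<noteq> {}}"
    unfolding beta_def using assms(3)
    by (intro Min_in[OF beta_candidates_finite[OF assms(1) W]]) blast+
  then show ?thesis using that by blast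
qed

lemma beta_valid:
  fixes V :: "'v set" and W :: "nat \<Rightarrow> 'v set"
  assumes "b > 1" and "finite V" and W: "\<And>i. i \<in> {1..m} \<Longrightarrow> W i \<subseteq> V"
    and "{1..m} \<noteq> {}" and \<alpha>: "\<And>U. U \<subseteq> V \<Longrightarrow> \<alpha> U \<ge> 0"
  shows "valid_coefficient TYPE('a \<times> 'z \<times> 'x) b V m W \<alpha> (beta V m W \<alpha>)"
  unfolding valid_coefficient_def
proof (intro allI impI)
  fix Q :: "'a measure" and N :: "nat \<Rightarrow> 'z measure" and Z and X :: "'v \<Rightarrow> 'a \<Rightarrow> 'x"
  assume adm: "admissible V m W Q N Z X"
  let ?I = "{1..m}" and ?J = "\<lambda>v. {i \<in> {1..m}. v \<in> W i}"
  interpret Q: prob_space Q using adm by (simp add: admissible_def)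
  have indep: "Q.indep_vars N Z ?I" using adm by (simp add: admissible_def)
  then have Z[measurable]: "Z i \<in> Q \<rightarrow>\<^sub>M N i" if "i \<in> ?I" for i
    using that by (auto simp: Q.indep_vars_def)
  have sX: "simple_function Q (X v)" if "v \<in> V" for v using adm that by (simp add: admissible_def)
  have "\<forall>v\<in>V. \<exists>g. g \<in> Pi\<^sub>M (?J v) N \<rightarrow>\<^sub>M count_space UNIV \<and>
      (\<forall>\<omega>\<in>space Q. X v \<omega> = g (\<lambda>i\<in>?J v. Z i \<omega>))"
    using adm unfolding admissible_def by blast
  from bchoice[OF this] obtain f where f: "\<And>v. v \<in> V \<Longrightarrow> f v \<in> Pi\<^sub>M (?J v) N \<rightarrow>\<^sub>M count_space UNIV"
    and Xf: "\<And>v \<omega>. v \<in> V \<Longrightarrow> \<omega> \<in> space Q \<Longrightarrow> X v \<omega> = f v (\<lambda>i\<in>?J v. Z i \<omega>)"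
    by blast
  \<comment> \<open>Outside the index set, any probability measure completes the family.\<close>
  define D where "D i = (if i \<in> ?I then distr Q (N i) (Z i) else return (count_space UNIV) undefined)" for i
  have "prob_space (D i)" for i
    using Z[of i] by (auto simp: D_def intro!: Q.prob_space_distr prob_space_return)
  then have "product_prob_space D" by (rule product_prob_spaceI)
  then have D: "finite_product_prob_space D ?I"
    by (simp add: finite_product_prob_space_def finite_product_sigma_finite_def
        product_prob_space_def finite_product_sigma_finite_axioms_def)
  interpret finite_product_prob_space D ?I by (rule D)
  define \<zeta> where "\<zeta> \<omega> = (\<lambda>i\<in>?I. Z i \<omega>)" for \<omega>
  have sets_\<Omega>: "sets \<Omega> = sets (Pi\<^sub>M ?I N)" by (intro sets_PiM_cong) (auto simp: D_def)
  have "\<zeta> \<in> Q \<rightarrow>\<^sub>M Pi\<^sub>M ?I N" unfolding \<zeta>_def by measurable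
  then have \<zeta>: "\<zeta> \<in> Q \<rightarrow>\<^sub>M \<Omega>" by (simp only: measurable_cong_sets[OF refl sets_\<Omega>])
  have "distr Q \<Omega> \<zeta> = distr Q (Pi\<^sub>M ?I N) \<zeta>" by (rule distr_cong[OF refl sets_\<Omega> refl])
  also have "\<dots> = (\<Pi>\<^sub>M i\<in>?I. distr Q (N i) (Z i))"
    using indep Q.indep_vars_iff_distr_eq_PiM'[OF assms(4), where X=Z and M'=N] Z by (simp add: \<zeta>_def[abs_def])
  also have "\<dots> = \<Omega>" by (intro PiM_cong) (auto simp: D_def)
  finally have distr_\<zeta>: "distr Q \<Omega> \<zeta> = \<Omega>" .
  \<comment> \<open>Off the range of \<open>\<zeta>\<close> the function \<open>f v\<close> may take infinitely many values, so it is truncated to the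
    values of \<open>X v\<close>; this does not affect \<open>X v\<close> itself.\<close>
  define X' where "X' v z = (let x = f v (restrict z (?J v)) in
    if x \<in> X v ` space Q then x else (SOME x. x \<in> X v ` space Q))" for v z
  have X'_in: "X' v z \<in> X v ` space Q" for v z
    using Q.not_empty by (auto simp: X'_def Let_def intro!: someI_ex[of "\<lambda>x. x \<in> X v ` space Q"])
  have X_X': "X v \<omega> = X' v (\<zeta> \<omega>)" if "v \<in> V" "\<omega> \<in> space Q" for v \<omega>
  proof -
    have "restrict (\<zeta> \<omega>) (?J v) = (\<lambda>i\<in>?J v. Z i \<omega>)" by (auto simp: \<zeta>_def)
    then have "f v (restrict (\<zeta> \<omega>) (?J v)) = X v \<omega>" using Xf[OF that] by simp
    then show ?thesis using that(2) by (simp add: X'_def)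
  qed
  have sX': "simple_function \<Omega> (X' v)" if v: "v \<in> V" for v
  proof -
    have "(\<lambda>z. f v (restrict z (?J v))) \<in> Pi\<^sub>M ?I N \<rightarrow>\<^sub>M count_space UNIV"
      by (rule measurable_compose[OF measurable_restrict_subset f[OF v]]) auto
    moreover have "(\<lambda>x. if x \<in> X v ` space Q then x else (SOME x. x \<in> X v ` space Q))
        \<in> count_space UNIV \<rightarrow>\<^sub>M count_space UNIV" by simp
    ultimately have "X' v \<in> Pi\<^sub>M ?I N \<rightarrow>\<^sub>M count_space UNIV"
      unfolding X'_def[abs_def] Let_def by (rule measurable_compose)
    then have "X' v \<in> \<Omega> \<rightarrow>\<^sub>M count_space UNIV" by (simp only: measurable_cong_sets[OF sets_\<Omega> refl])
    moreover have "finite (X' v ` space \<Omega>)"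
      using X'_in by (intro finite_subset[OF _ simple_functionD(1)[OF sX[OF v]]]) auto
    ultimately show ?thesis
      unfolding simple_function_def by (auto intro: measurable_sets)
  qed
  have ent: "H Q b (X v) = cond_entropy {} (X' v) / ln b" if "v \<in> V" for v
    using that by (intro entropy_eq_cond_entropy_empty[OF Q.prob_space_axioms \<open>b > 1\<close> \<zeta> distr_\<zeta> sX' X_X'])
  have ent_joint: "H Q b (joint X U) = cond_entropy {} (joint X' U) / ln b" if "U \<in> Pow V" for U
  proof (rule entropy_eq_cond_entropy_empty[OF Q.prob_space_axioms \<open>b > 1\<close> \<zeta> distr_\<zeta>])
    show "simple_function \<Omega> (joint X' U)"
      using that \<open>finite V\<close> by (intro simple_function_joint sX') (auto dest: finite_subset)
    show "joint X U \<omega> = joint X' U (\<zeta> \<omega>)" if "\<omega> \<in> space Q" for \<omega>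
      using that \<open>U \<in> Pow V\<close> X_X' by (auto simp: joint_def fun_eq_iff)
  qed
  have sum_ent: "(\<Sum>v\<in>V. H Q b (X v)) = (\<Sum>v\<in>V. cond_entropy {} (X' v)) / ln b"
    unfolding sum_divide_distrib by (rule sum.cong[OF refl ent])
  have sum_ent_joint: "(\<Sum>U\<in>Pow V. \<alpha> U * H Q b (joint X U)) = (\<Sum>U\<in>Pow V. \<alpha> U * cond_entropy {} (joint X' U)) / ln b"
    unfolding sum_divide_distrib by (rule sum.cong[OF refl]) (simp only: ent_joint times_divide_eq_right)
  have "beta V m W \<alpha> * (\<Sum>v\<in>V. cond_entropy {} (X' v)) \<le> (\<Sum>U\<in>Pow V. \<alpha> U * cond_entropy {} (joint X' U))"
  proof (rule weighted_entropy_bound_product[OF D \<open>finite V\<close> W \<alpha> beta_le[OF \<open>finite V\<close> W] sX'])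
    fix v and \<omega> \<omega>' :: "nat \<Rightarrow> 'z"
    assume "\<And>i. i \<in> ?I \<Longrightarrow> v \<in> W i \<Longrightarrow> \<omega> i = \<omega>' i"
    then have "restrict \<omega> (?J v) = restrict \<omega>' (?J v)" by auto
    then show "X' v \<omega> = X' v \<omega>'" by (simp add: X'_def)
  qed
  then have "beta V m W \<alpha> * (\<Sum>v\<in>V. cond_entropy {} (X' v)) / ln b
      \<le> (\<Sum>U\<in>Pow V. \<alpha> U * cond_entropy {} (joint X' U)) / ln b"
    using \<open>b > 1\<close> by (intro divide_right_mono) auto
  then show "beta V m W \<alpha> * (\<Sum>v\<in>V. H Q b (X v)) \<le> (\<Sum>U\<in>Pow V. \<alpha> U * H Q b (joint X U))"
    using sum_ent sum_ent_joint by simp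
qed

section \<open>Sharpness\<close>

lemma (in prob_space) indep_vars_trivial_except:
  assumes rv: "\<And>j. j \<in> I \<Longrightarrow> random_variable (N j) (Z j)"
    and triv: "\<And>j A. j \<in> I \<Longrightarrow> j \<noteq> i \<Longrightarrow> A \<in> sets (N j) \<Longrightarrow> A = {} \<or> A = space (N j)"
  shows "indep_vars N Z I"
  unfolding indep_vars_def2
proof (intro conjI ballI rv)
  let ?F = "\<lambda>j. {Z j -` A \<inter> space M |A. A \<in> sets (N j)}"
  have F: "A = {} \<or> A = space M" if "A \<in> ?F j" "j \<in> I" "j \<noteq> i" for A j
  proof -
    from that(1) obtain B where B: "A = Z j -` B \<inter> space M" "B \<in> sets (N j)" by auto
    from triv[OF that(2,3) B(2)] show ?thesis
      using measurable_space[OF rv[OF that(2)]] by (auto simp: B(1))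
  qed
  show "indep_sets ?F I"
    unfolding indep_sets_def
  proof (intro conjI ballI allI impI)
    fix j assume "j \<in> I"
    then show "?F j \<subseteq> events" using measurable_sets[OF rv] by auto
  next
    fix J A assume J: "J \<subseteq> I" "J \<noteq> {}" "finite J" and A: "A \<in> Pi J ?F"
    show "prob (\<Inter>j\<in>J. A j) = (\<Prod>j\<in>J. prob (A j))"
    proof (cases "\<exists>j\<in>J. A j = {}")
      case True
      then have "(\<Inter>j\<in>J. A j) = {}" by auto
      moreover have "(\<Prod>j\<in>J. prob (A j)) = 0" using True by (intro prod_zero[OF J(3)]) (metis measure_empty)
      ultimately show ?thesis by simp
    next
      case False
      have full: "A j = space M" if "j \<in> J - {i}" for j
        using F[of "A j" j] A J(1) that False by auto
      show ?thesis
      proof (cases "i \<in> J")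
        case True
        have "A i \<in> ?F i" using A True by auto
        then have "A i \<subseteq> space M" by auto
        then have "(\<Inter>j\<in>J. A j) = A i" using full True by blast
        moreover have "(\<Prod>j\<in>J. prob (A j)) = prob (A i)"
          using full by (subst prod.remove[OF J(3) True]) (simp add: prob_space)
        ultimately show ?thesis by simp
      next
        case False
        then have "A j = space M" if "j \<in> J" for j using full that by auto
        then show ?thesis using J(2) by (simp add: prob_space)
      qed
    qed
  qed
qed

lemma entropy_fair_bit:
  assumes "s \<noteq> t" and "b > 1"
  shows "H (measure_pmf (pmf_of_set {s, t})) b (\<lambda>\<omega>. if \<omega> = s then x else y) = (if x = y then 0 else log b 2)"
proof -
  let ?M = "measure_pmf (pmf_of_set {s, t})" and ?X = "\<lambda>\<omega>. if \<omega> = s then x else y"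
  interpret information_space ?M b
    using assms(2) by unfold_locales
  have fin: "finite (range ?X)" by (rule finite_subset[of _ "{x, y}"]) auto
  then have sf: "simple_function ?M ?X" by (simp add: simple_function_def)
  have range: "range ?X = {x, y}" using assms(1) by (auto simp: image_iff)
  have pr: "measure ?M A = real (card ({s, t} \<inter> A)) / 2" for A
    using assms(1) by (subst measure_pmf_of_set) auto
  have st: "{s, t} \<inter> {s} = {s}" "{s, t} \<inter> - {s} = {t}" using assms(1) by auto
  show ?thesis
  proof (cases "x = y")
    case True
    then have "?X -` {y} = UNIV" by auto
    then show ?thesis
      unfolding H_eq_sum[OF information_space_axioms sf] space_measure_pmf range
      using True assms(1) by (simp add: pr)
  next
    case False
    then have "?X -` {x} = {s}" "?X -` {y} = - {s}" by (auto split: if_splits)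
    then show ?thesis
      unfolding H_eq_sum[OF information_space_axioms sf] space_measure_pmf range
      using False assms by (simp add: pr st log_divide)
  qed
qed

text \<open>Test the inequality on one fair bit \<open>Z i\<close>, copied by the \<open>X v\<close> with \<open>v \<in> S\<close>. The other
  \<open>N j\<close> carry the trivial \<open>\<sigma>\<close>-algebra, so independence holds although all \<open>Z j\<close> are the same function.\<close>

lemma valid_coefficient_le:
  fixes V :: "'v set" and s t :: 'a and z\<^sub>0 z\<^sub>1 :: 'z and x\<^sub>0 x\<^sub>1 :: 'x
  assumes valid: "valid_coefficient TYPE('a \<times> 'z \<times> 'x) b V m W \<alpha> c"
    and "b > 1" and "finite V" and i: "i \<in> {1..m}" and S: "S \<subseteq> W i" "S \<subseteq> V"
    and ne: "s \<noteq> t" "z\<^sub>0 \<noteq> z\<^sub>1" "x\<^sub>0 \<noteq> x\<^sub>1"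
  shows "c * real (card S) \<le> (\<Sum>U\<in>{U. U \<subseteq> V \<and> U \<inter> S \<noteq> {}}. \<alpha> U)"
proof -
  let ?M = "measure_pmf (pmf_of_set {s, t})"
  define N :: "nat \<Rightarrow> 'z measure" where "N j = (if j = i then count_space UNIV else sigma UNIV {})" for j
  define Z where "Z j \<omega> = (if \<omega> = s then z\<^sub>0 else z\<^sub>1)" for j :: nat and \<omega>
  define X where "X v \<omega> = (if \<omega> = s then if v \<in> S then x\<^sub>0 else x\<^sub>1 else x\<^sub>1)" for v \<omega>
  have "admissible V m W ?M N Z X"
    unfolding admissible_def
  proof (intro conjI ballI)
    show "prob_space ?M" by (rule measure_pmf.prob_space_axioms)
    show "prob_space.indep_vars ?M N Z {1..m}"
    proof (rule measure_pmf.indep_vars_trivial_except[where i=i])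
      show "A = {} \<or> A = space (N j)" if "j \<noteq> i" "A \<in> sets (N j)" for j A
        using that by (auto simp: N_def sigma_sets_empty_eq)
    qed (auto simp: N_def space_measure_of_conv)
    fix v assume "v \<in> V"
    have "finite (range (X v))"
      by (rule finite_subset[of _ "{x\<^sub>0, x\<^sub>1}"]) (auto simp: X_def)
    then show "simple_function ?M (X v)" by (simp add: simple_function_def)
    let ?J = "{j \<in> {1..m}. v \<in> W j}"
    show "\<exists>f\<in>Pi\<^sub>M ?J N \<rightarrow>\<^sub>M count_space UNIV. \<forall>\<omega>\<in>space ?M. X v \<omega> = f (\<lambda>j\<in>?J. Z j \<omega>)"
    proof (cases "v \<in> S")
      case True
      then have iJ: "i \<in> ?J" using i S by auto
      have "(\<lambda>z. z i) \<in> Pi\<^sub>M ?J N \<rightarrow>\<^sub>M count_space UNIV"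
        using measurable_component_singleton[OF iJ, of N] by (simp add: N_def)
      then have "(\<lambda>z. if z i = z\<^sub>0 then x\<^sub>0 else x\<^sub>1) \<in> Pi\<^sub>M ?J N \<rightarrow>\<^sub>M count_space UNIV"
        by (rule measurable_compose) simp
      moreover have "X v \<omega> = (\<lambda>z. if z i = z\<^sub>0 then x\<^sub>0 else x\<^sub>1) (\<lambda>j\<in>?J. Z j \<omega>)" for \<omega>
        using True iJ ne by (simp add: X_def Z_def)
      ultimately show ?thesis by (intro bexI[of _ "\<lambda>z. if z i = z\<^sub>0 then x\<^sub>0 else x\<^sub>1"] ballI)
    next
      case False
      then show ?thesis by (intro bexI[of _ "\<lambda>_. x\<^sub>1"]) (auto simp: X_def)
    qed
  qed
  then have le: "c * (\<Sum>v\<in>V. H ?M b (X v)) \<le> (\<Sum>U\<in>Pow V. \<alpha> U * H ?M b (joint X U))"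
    using valid unfolding valid_coefficient_def by blast
  have L: "0 < log b 2" using \<open>b > 1\<close> by simp
  have HX: "H ?M b (X v) = (if v \<in> S then log b 2 else 0)" for v
    unfolding X_def[abs_def] entropy_fair_bit[OF ne(1) \<open>b > 1\<close>] using ne(3) by simp
  have HJ: "H ?M b (joint X U) = (if U \<inter> S \<noteq> {} then log b 2 else 0)" for U
  proof -
    have "joint X U = (\<lambda>\<omega>. if \<omega> = s then (\<lambda>v\<in>U. if v \<in> S then x\<^sub>0 else x\<^sub>1) else (\<lambda>v\<in>U. x\<^sub>1))"
      by (auto simp: joint_def X_def fun_eq_iff)
    moreover have "(\<lambda>v\<in>U. if v \<in> S then x\<^sub>0 else x\<^sub>1) = (\<lambda>v\<in>U. x\<^sub>1) \<longleftrightarrow> U \<inter> S = {}"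
      using ne(3) by (auto simp: fun_eq_iff restrict_def split: if_splits)
    ultimately show ?thesis
      by (simp add: entropy_fair_bit[OF ne(1) \<open>b > 1\<close>])
  qed
  have "(\<Sum>v\<in>V. H ?M b (X v)) = real (card S) * log b 2"
    using \<open>finite V\<close> S(2) by (simp add: HX sum.If_cases Int_absorb1)
  moreover have "(\<Sum>U\<in>Pow V. \<alpha> U * H ?M b (joint X U)) = (\<Sum>U\<in>{U. U \<subseteq> V \<and> U \<inter> S \<noteq> {}}. \<alpha> U) * log b 2"
  proof -
    have "{U. U \<subseteq> V \<and> U \<inter> S \<noteq> {}} = {U \<in> Pow V. U \<inter> S \<noteq> {}}" by auto
    then show ?thesis
      using \<open>finite V\<close> by (simp only: HJ) (subst sum.inter_filter, auto simp: sum_distrib_right intro!: sum.cong)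
  qed
  ultimately have "(c * real (card S)) * log b 2 \<le> (\<Sum>U\<in>{U. U \<subseteq> V \<and> U \<inter> S \<noteq> {}}. \<alpha> U) * log b 2"
    using le by simp
  then show ?thesis using L by (simp only: mult_le_cancel_right_pos)
qed

section \<open>The optimal coefficient\<close>

(* The two-element conditions only exclude types too small to carry a non-constant random
   variable: there all entropies vanish and every coefficient is valid. *)
theorem theorem2p5:
  fixes V :: "'v set" and m :: nat and W :: "nat \<Rightarrow> 'v set"
    and \<alpha> :: "'v set \<Rightarrow> real" and b :: real
  assumes "b > 1"
    and "finite V"
    and "\<And>i. i \<in> {1..m} \<Longrightarrow> W i \<subseteq> V"
    and "\<exists>i\<in>{1..m}. W i \<noteq> {}"
    and "\<And>U. U \<subseteq> V \<Longrightarrow> \<alpha> U \<ge> 0"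
  shows "valid_coefficient TYPE('a \<times> 'z \<times> 'x) b V m W \<alpha> (beta V m W \<alpha>) \<and>
    ((\<exists>s t :: 'a. s \<noteq> t) \<and> (\<exists>s t :: 'z. s \<noteq> t) \<and> (\<exists>s t :: 'x. s \<noteq> t) \<longrightarrow>
      (\<forall>c. valid_coefficient TYPE('a \<times> 'z \<times> 'x) b V m W \<alpha> c \<longrightarrow> c \<le> beta V m W \<alpha>))"
proof (intro conjI impI allI)
  show "valid_coefficient TYPE('a \<times> 'z \<times> 'x) b V m W \<alpha> (beta V m W \<alpha>)"
    using assms(4) by (intro beta_valid assms(1-3,5)) auto
next
  fix c
  assume "(\<exists>s t :: 'a. s \<noteq> t) \<and> (\<exists>s t :: 'z. s \<noteq> t) \<and> (\<exists>s t :: 'x. s \<noteq> t)"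
  then obtain s t :: 'a and z\<^sub>0 z\<^sub>1 :: 'z and x\<^sub>0 x\<^sub>1 :: 'x where ne: "s \<noteq> t" "z\<^sub>0 \<noteq> z\<^sub>1" "x\<^sub>0 \<noteq> x\<^sub>1" by blast
  assume valid: "valid_coefficient TYPE('a \<times> 'z \<times> 'x) b V m W \<alpha> c"
  obtain i S where iS: "i \<in> {1..m}" "S \<subseteq> W i" "S \<noteq> {}"
    and beta: "beta V m W \<alpha> = (\<Sum>U\<in>{U. U \<subseteq> V \<and> U \<inter> S \<noteq> {}}. \<alpha> U) / real (card S)"
    using beta_attained[OF assms(2-4), of \<alpha>] by blast
  have SV: "S \<subseteq> V" using iS(1,2) assms(3) by blast
  then have "real (card S) > 0"
    using iS(3) finite_subset[OF _ assms(2)] by (simp add: card_gt_0_iff)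
  then show "c \<le> beta V m W \<alpha>"
    unfolding beta using valid_coefficient_le[OF valid assms(1,2) iS(1,2) SV ne] by (simp add: pos_le_divide_eq)
qed

end
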